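(* Let $m$ and $n$ be nonnegative integers with the same parity, and let $l$ be a nonnegative integer. Let $A$ and $B$ be $m \times m$ and $n \times n$ skew-symmetric matrices, and let $S$ and $T$ be $m \times l$ and $n \times l$ matrices. Then $$ \sum_K (-1)^{ \binom{\# K}{2} } \operatorname{Pf} \begin{pmatrix} A & S([m];K) \\ -{}^t S([m];K) & O \end{pmatrix} \operatorname{Pf} \begin{pmatrix} B & T([n];K) \\ -{}^t T([n];K) & O \end{pmatrix} = \operatorname{Pf} \begin{pmatrix} A & S\, {}^t T \\ - T\, {}^t S & B \end{pmatrix} $$ and $$ \sum_K \operatorname{Pf} \begin{pmatrix} A & S([m];K) \\ -{}^t S([m];K) & O \end{pmatrix} \operatorname{Pf} \begin{pmatrix} B & T([n];K) \\ -{}^t T([n];K) & O \end{pmatrix} = (-1)^{ \binom{n}{2} } \operatorname{Pf} \begin{pmatrix} A & S\, {}^t T \\ - T\, {}^t S & -B \end{pmatrix}, $$ where in both sums $K$ runs over all subsets of $[l]$ with $\# K \equiv m \equiv n \bmod 2$.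
   Context: All matrices have entries in a fixed commutative ring; skew-symmetric means ${}^tX=-X$ with zero diagonal, where ${}^tX$ is the transpose. For a skew-symmetric matrix $X=(x_{ij})_{1\le i,j\le 2r}$ of even order, the Pfaffian is $$\operatorname{Pf}(X)=\sum_{\sigma\in F_{2r}}\operatorname{sgn}(\sigma)\prod_{i=1}^r x_{\sigma(2i-1),\sigma(2i)},$$ where $F_{2r}$ is the set of permutations $\sigma\in S_{2r}$ with $\sigma(1)<\sigma(3)<\dots<\sigma(2r-1)$ and $\sigma(2i-1)<\sigma(2i)$ for $1\le i\le r$. The Pfaffian of the empty ($0\times 0$) matrix is $1$. We write $[n]=\{1,2,\dots,n\}$. For an $M\times N$ matrix $X$ and subsets $I\subset[M]$, $J\subset[N]$, $X(I;J)$ denotes the submatrix of $X$ with rows indexed by $I$ and columns indexed by $J$ (in increasing order). $O$ denotes a zero matrix of the appropriate size, and $\#K$ is the cardinality of $K$. *)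

theory Defs
  imports
    "Jordan_Normal_Form.Determinant"
    "Jordan_Normal_Form.DL_Submatrix"
begin

text \<open>
  Rows and columns are indexed from 0, as in the matrix library: the index set \<open>[n] = {1, \<dots>, n}\<close>
  becomes \<open>{0..<n}\<close>.  \<open>submatrix X I J\<close> keeps the rows in \<open>I\<close> and the columns in \<open>J\<close>, in
  increasing order.
\<close>

text \<open>The zero diagonal is a separate condition because 2 may be a zero divisor.\<close>

definition skew_symmetric_mat :: "'a::ring mat \<Rightarrow> bool" where
  "skew_symmetric_mat X \<longleftrightarrow> X\<^sup>T = - X \<and> (\<forall>i<dim_row X. X $$ (i, i) = 0)"

text \<open>
  The set \<open>F\<^sub>2\<^sub>r\<close>: in 1-based terms, \<open>\<sigma>(1) < \<sigma>(3) < \<dots> < \<sigma>(2r - 1)\<close> and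
  \<open>\<sigma>(2i - 1) < \<sigma>(2i)\<close> for \<open>1 \<le> i \<le> r\<close>.
\<close>

definition pfaffian_perms :: "nat \<Rightarrow> (nat \<Rightarrow> nat) set" where
  "pfaffian_perms r = {\<sigma>. \<sigma> permutes {0..<2 * r} \<and>
     (\<forall>i j. i < j \<and> j < r \<longrightarrow> \<sigma> (2 * i) < \<sigma> (2 * j)) \<and>
     (\<forall>i<r. \<sigma> (2 * i) < \<sigma> (2 * i + 1))}"

text \<open>The value 0 for matrices that are not square of even order is a convention.\<close>

definition Pf :: "'a::comm_ring_1 mat \<Rightarrow> 'a" where
  "Pf X = (if dim_row X = dim_col X \<and> even (dim_row X) then
     (\<Sum>\<sigma>\<in>pfaffian_perms (dim_row X div 2).
        signof \<sigma> * (\<Prod>i = 0..<dim_row X div 2. X $$ (\<sigma> (2 * i), \<sigma> (2 * i + 1))))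
     else 0)"

lemma Pf_empty: "Pf (0\<^sub>m 0 0 :: 'a::comm_ring_1 mat) = 1"
  by (simp add: Pf_def pfaffian_perms_def)

end

theory Submission
  imports Defs
begin

text \<open>
  Both sides of the first identity satisfy the same recursion when expanded along the first row
  \<open>p\<close> of \<open>A\<close>. On the left, an entry \<open>S p k\<close> removes the index \<open>k\<close> from \<open>K\<close>, leaving \<open>K'\<close>; moving
  \<open>k\<close> to the front of the second Pfaffian and expanding along it pairs \<open>S p k\<close> with \<open>T q k\<close>.
  For fixed \<open>K'\<close> the sum over \<open>k \<notin> K'\<close> extends to all \<open>k\<close>, because a Pfaffian with a repeated
  index vanishes, and so produces the entries of \<open>S T\<^sup>T\<close>. The second identity is the first one
  for \<open>- B\<close>: negating the bordered matrix and then its last \<open>card K\<close> rows and columns turns \<open>- B\<close>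
  back into \<open>B\<close> at the cost of a sign.
\<close>

subsection \<open>Expansion of the Pfaffian along the first row\<close>

text \<open>Entries come from a function instead of a matrix, so that passing to a minor is a
  substitution of indices.\<close>

definition pfaffian_sum :: "nat \<Rightarrow> (nat \<Rightarrow> nat \<Rightarrow> 'a::comm_ring_1) \<Rightarrow> 'a" where
  "pfaffian_sum r h =
     (\<Sum>\<sigma>\<in>pfaffian_perms r. signof \<sigma> * (\<Prod>i = 0..<r. h (\<sigma> (2 * i)) (\<sigma> (2 * i + 1))))"

lemma permutation_delete_insert: "permutation_delete (permutation_insert i j p) i = p"
  by (rule ext) (auto simp: permutation_delete_expand permutation_insert_expand)

lemma insert_index_less_iff [simp]: "insert_index j a < insert_index j b \<longleftrightarrow> a < b"
  by (auto simp: insert_index_def)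

text \<open>
  The bijection of \<open>F\<^sub>2\<^sub>r\<close> with the elements of \<open>F\<^sub>2\<^sub>r\<^sub>+\<^sub>2\<close> that match 0 with \<open>j + 1\<close>; 0 always
  comes first.
\<close>

definition extend_matching :: "nat \<Rightarrow> (nat \<Rightarrow> nat) \<Rightarrow> nat \<Rightarrow> nat" where
  "extend_matching j \<sigma> = permutation_insert 0 0 (permutation_insert 0 j \<sigma>)"

lemma extend_matching_simps [simp]:
  "extend_matching j \<sigma> 0 = 0"
  "extend_matching j \<sigma> (Suc 0) = Suc j"
  "extend_matching j \<sigma> (Suc (Suc i)) = Suc (insert_index j (\<sigma> i))"
  by (simp_all add: extend_matching_def permutation_insert_expand insert_index_def)

text \<open>The new first pair \<open>(0, j + 1)\<close> starts with the least value, and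
  \<open>Suc\<close> after \<open>insert_index j\<close> is strictly increasing, so the order
  conditions transfer both ways: one direction builds matchings, the other decomposes them.\<close>

lemma extend_matching_order_iff:
  "(\<forall>i k. i < k \<and> k < Suc r \<longrightarrow> extend_matching j \<sigma> (2 * i) < extend_matching j \<sigma> (2 * k)) \<and>
   (\<forall>i<Suc r. extend_matching j \<sigma> (2 * i) < extend_matching j \<sigma> (2 * i + 1)) \<longleftrightarrow>
   (\<forall>i k. i < k \<and> k < r \<longrightarrow> \<sigma> (2 * i) < \<sigma> (2 * k)) \<and> (\<forall>i<r. \<sigma> (2 * i) < \<sigma> (2 * i + 1))"
  (is "?A \<and> ?B \<longleftrightarrow> ?C \<and> ?D")
proof -
  have "?A \<longleftrightarrow> ?C"
  proof (intro iffI allI impI)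
    fix i k assume "?A" "i < k \<and> k < r"
    then have "extend_matching j \<sigma> (2 * Suc i) < extend_matching j \<sigma> (2 * Suc k)" by blast
    then show "\<sigma> (2 * i) < \<sigma> (2 * k)" by simp
  next
    fix i k assume c: "?C" and ik: "i < k \<and> k < Suc r"
    then obtain k' where k: "k = Suc k'" by (cases k) auto
    show "extend_matching j \<sigma> (2 * i) < extend_matching j \<sigma> (2 * k)"
      using c ik unfolding k by (cases i) auto
  qed
  moreover have "?B \<longleftrightarrow> ?D"
    by (auto simp: less_Suc_eq_0_disj)
  ultimately show ?thesis by blast
qed

lemma extend_matching_in_pfaffian_perms:
  assumes "j < Suc (2 * r)" "\<sigma> \<in> pfaffian_perms r"
  shows "extend_matching j \<sigma> \<in> pfaffian_perms (Suc r)"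
proof -
  have "\<sigma> permutes {0..<2 * r}" using assms(2) by (simp add: pfaffian_perms_def)
  then have "extend_matching j \<sigma> permutes {0..<2 * Suc r}"
    using permutation_insert_permutes[of _ _ 0] assms(1) by (simp add: extend_matching_def)
  then show ?thesis
    using assms(2) extend_matching_order_iff[of r j \<sigma>] by (simp add: pfaffian_perms_def)
qed

text \<open>If 0 stood at a later even position, the order of the first components would fail; at an
  odd position, the order inside a pair would.\<close>

lemma pfaffian_perms_0:
  assumes "\<sigma> \<in> pfaffian_perms (Suc r)"
  shows "\<sigma> 0 = 0"
proof (rule ccontr)
  assume neq: "\<sigma> 0 \<noteq> 0"
  have p: "\<sigma> permutes {0..<2 * Suc r}" using assms by (simp add: pfaffian_perms_def)
  then have "0 \<in> \<sigma> ` {0..<2 * Suc r}" using permutes_image[OF p] by simp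
  then obtain k where k: "\<sigma> k = 0" "k < 2 * Suc r" by auto
  define i where "i = k div 2"
  have i: "i < Suc r" using k(2) by (simp add: i_def)
  consider "k = 2 * i" | "k = 2 * i + 1" unfolding i_def by linarith
  then show False
  proof cases
    case 1
    then have "0 < i" using k(1) neq by (cases i) auto
    then have "\<sigma> (2 * 0) < \<sigma> (2 * i)" using assms i unfolding pfaffian_perms_def by blast
    then show False using 1 k(1) by simp
  next
    case 2
    have "\<sigma> (2 * i) < \<sigma> (2 * i + 1)" using assms i unfolding pfaffian_perms_def by blast
    then show False using 2 k(1) by simp
  qed
qed

text \<open>Deleting position 0 twice removes the value 0 and then its partner;
  \<open>\<tau> 0\<close> is the partner lowered by one, since the value 0 is already gone.\<close>

lemma pfaffian_perms_SucE:
  assumes "\<sigma> \<in> pfaffian_perms (Suc r)"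
  obtains j \<rho> where "j < Suc (2 * r)" "\<rho> \<in> pfaffian_perms r" "\<sigma> = extend_matching j \<rho>"
proof -
  have p: "\<sigma> permutes {0..<Suc (Suc (2 * r))}" using assms by (simp add: pfaffian_perms_def)
  define \<tau> where "\<tau> = permutation_delete \<sigma> 0"
  have \<tau>: "\<tau> permutes {0..<Suc (2 * r)}"
    unfolding \<tau>_def using permutation_delete_permutes[OF p] by simp
  define \<rho> where "\<rho> = permutation_delete \<tau> 0"
  have \<rho>: "\<rho> permutes {0..<2 * r}"
    unfolding \<rho>_def using permutation_delete_permutes[OF \<tau>] by simp
  have j: "\<tau> 0 < Suc (2 * r)" using permutes_in_image[OF \<tau>, of 0] by simp
  have "\<sigma> = permutation_insert 0 0 \<tau>"
    using permutation_insert_delete[OF p, of 0] pfaffian_perms_0[OF assms] by (simp add: \<tau>_def)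
  also have "\<tau> = permutation_insert 0 (\<tau> 0) \<rho>"
    using permutation_insert_delete[OF \<tau>, of 0] by (simp add: \<rho>_def)
  finally have eq: "\<sigma> = extend_matching (\<tau> 0) \<rho>" by (simp only: extend_matching_def)
  have "\<rho> \<in> pfaffian_perms r"
    using assms \<rho> extend_matching_order_iff[of r "\<tau> 0" \<rho>] unfolding eq pfaffian_perms_def by simp
  then show thesis using that j eq by blast
qed

text \<open>Inserting the value \<open>j\<close> at position 0 creates \<open>j\<close> inversions;
  the outer insertion of 0 at position 0 creates none.\<close>

lemma signof_extend_matching:
  assumes "j < Suc (2 * r)" "\<sigma> \<in> pfaffian_perms r"
  shows "signof (extend_matching j \<sigma>) = (- 1 :: 'a::comm_ring_1) ^ j * signof \<sigma>"
proof -
  have p: "\<sigma> permutes {0..<2 * r}" using assms(2) by (simp add: pfaffian_perms_def)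
  have q: "permutation_insert 0 j \<sigma> permutes {0..<Suc (2 * r)}"
    using permutation_insert_permutes[OF p _ assms(1)] by simp
  show ?thesis
    unfolding extend_matching_def
    using signof_permutation_insert[OF q, of 0 0, where ?'a='a]
      signof_permutation_insert[OF p _ assms(1), of 0, where ?'a='a] by simp
qed

lemma inj_extend_matching: "inj (\<lambda>(j, \<sigma>). extend_matching j \<sigma>)"
proof (rule injI, clarsimp)
  fix j k \<sigma> \<rho> assume eq: "extend_matching j \<sigma> = extend_matching k \<rho>"
  have "j = k" using fun_cong[OF eq, of "Suc 0"] by simp
  moreover have "\<sigma> = \<rho>"
    using arg_cong[OF eq, of "\<lambda>p. permutation_delete (permutation_delete p 0) 0"]
    by (simp add: extend_matching_def permutation_delete_insert)
  ultimately show "j = k \<and> \<sigma> = \<rho>" by simp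
qed

text \<open>The matchings are grouped by the partner \<open>j + 1\<close> of 0. \<open>Suc\<close>
  after \<open>insert_index j\<close> enumerates the indices other than 0 and \<open>j + 1\<close>,
  so the inner sum is the Pfaffian of the minor without these two.\<close>

lemma pfaffian_sum_Suc:
  fixes h :: "nat \<Rightarrow> nat \<Rightarrow> 'a::comm_ring_1"
  shows "pfaffian_sum (Suc r) h =
    (\<Sum>j<Suc (2 * r). (- 1) ^ j * h 0 (Suc j) *
       pfaffian_sum r (\<lambda>a b. h (Suc (insert_index j a)) (Suc (insert_index j b))))"
proof -
  let ?D = "{..<Suc (2 * r)} \<times> pfaffian_perms r"
  let ?t = "\<lambda>\<sigma>. signof \<sigma> * (\<Prod>i = 0..<Suc r. h (\<sigma> (2 * i)) (\<sigma> (2 * i + 1)))"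
  have img: "(\<lambda>(j, \<sigma>). extend_matching j \<sigma>) ` ?D = pfaffian_perms (Suc r)"
    using extend_matching_in_pfaffian_perms
    by (auto elim!: pfaffian_perms_SucE simp: image_iff)
  have "pfaffian_sum (Suc r) h = (\<Sum>(j, \<sigma>)\<in>?D. ?t (extend_matching j \<sigma>))"
    unfolding pfaffian_sum_def img[symmetric]
    by (subst sum.reindex[OF inj_on_subset[OF inj_extend_matching]])
      (auto intro!: sum.cong)
  also have "\<dots> = (\<Sum>(j, \<sigma>)\<in>?D. (- 1) ^ j * h 0 (Suc j) *
     (signof \<sigma> * (\<Prod>i = 0..<r. h (Suc (insert_index j (\<sigma> (2 * i))))
        (Suc (insert_index j (\<sigma> (2 * i + 1)))))))"
    by (intro sum.cong) (auto simp: signof_extend_matching prod.atLeast0_lessThan_Suc_shift simp del: prod.op_ivl_Suc)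
  also have "\<dots> = (\<Sum>j<Suc (2 * r). (- 1) ^ j * h 0 (Suc j) *
       pfaffian_sum r (\<lambda>a b. h (Suc (insert_index j a)) (Suc (insert_index j b))))"
    by (simp add: sum.cartesian_product[symmetric] pfaffian_sum_def sum_distrib_left)
  finally show ?thesis .
qed

lemma pfaffian_sum_cong:
  assumes "\<And>a b. a < 2 * r \<Longrightarrow> b < 2 * r \<Longrightarrow> h a b = h' a b"
  shows "pfaffian_sum r h = pfaffian_sum r h'"
proof -
  have "\<sigma> i < 2 * r" if "\<sigma> \<in> pfaffian_perms r" "i < 2 * r" for \<sigma> i
    using that permutes_in_image[of \<sigma> "{0..<2 * r}" i] by (simp add: pfaffian_perms_def)
  then show ?thesis
    unfolding pfaffian_sum_def
    by (intro sum.cong prod.cong refl arg_cong2[of _ _ _ _ "(*)"]) (auto intro!: assms)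
qed

lemma pfaffian_sum_0: "pfaffian_sum 0 h = 1"
  by (simp add: pfaffian_sum_def pfaffian_perms_def)

lemma Pf_mat:
  "Pf (mat (2 * r) (2 * r) (\<lambda>(i, j). h i j)) = pfaffian_sum r h"
proof -
  have "Pf (mat (2 * r) (2 * r) (\<lambda>(i, j). h i j)) =
      pfaffian_sum r (\<lambda>i j. mat (2 * r) (2 * r) (\<lambda>(i, j). h i j) $$ (i, j))"
    unfolding Pf_def pfaffian_sum_def by simp
  also have "\<dots> = pfaffian_sum r h"
    by (rule pfaffian_sum_cong) simp
  finally show ?thesis .
qed

section \<open>Pfaffians indexed by lists, and alternating sums over removals\<close>

text \<open>A list as index sequence turns removing, repeating and permuting rows together with
  columns into list operations.\<close>

definition pf :: "('b \<Rightarrow> 'b \<Rightarrow> 'a::comm_ring_1) \<Rightarrow> 'b list \<Rightarrow> 'a" where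
  "pf f xs = Pf (mat (length xs) (length xs) (\<lambda>(i, j). f (xs ! i) (xs ! j)))"

text \<open>
  The alternating sum of \<open>F y ys\<close> over all ways to remove an entry \<open>y\<close> from a list, \<open>ys\<close> being what
  remains.
\<close>

primrec esum :: "('b \<Rightarrow> 'b list \<Rightarrow> 'a::comm_ring_1) \<Rightarrow> 'b list \<Rightarrow> 'a" where
  "esum F [] = 0"
| "esum F (x # xs) = F x xs - esum (\<lambda>y ys. F y (x # ys)) xs"

lemma esum_nth:
  "esum F xs = (\<Sum>i<length xs. (- 1) ^ i * F (xs ! i) (take i xs @ drop (Suc i) xs))"
  by (induction xs arbitrary: F)
    (simp_all add: sum.lessThan_Suc_shift sum_negf[symmetric] del: sum.lessThan_Suc)

text \<open>The multiset of \<open>y # ys\<close> determines the length of \<open>ys\<close> and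
  products over it, which is what the applications use, and this hypothesis passes through the
  recursion of \<open>esum\<close>.\<close>

lemma esum_cong:
  assumes "\<And>y ys. mset (y # ys) = mset xs \<Longrightarrow> F y ys = G y ys"
  shows "esum F xs = esum G xs"
  using assms
proof (induction xs arbitrary: F G)
  case (Cons x xs)
  have "esum (\<lambda>y ys. F y (x # ys)) xs = esum (\<lambda>y ys. G y (x # ys)) xs"
    by (rule Cons.IH, rule Cons.prems) (simp add: add_mset_commute)
  moreover have "F x xs = G x xs" by (rule Cons.prems) simp
  ultimately show ?case by simp
qed simp

lemma esum_zero [simp]: "esum (\<lambda>y ys. 0) xs = 0"
  by (induction xs) simp_all

lemma esum_add: "esum (\<lambda>y ys. F y ys + G y ys) xs = esum F xs + esum G xs"
  by (induction xs arbitrary: F G) simp_all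

lemma esum_diff: "esum (\<lambda>y ys. F y ys - G y ys) xs = esum F xs - esum G xs"
  by (induction xs arbitrary: F G) simp_all

lemma esum_cmult: "esum (\<lambda>y ys. c * F y ys) xs = c * esum F xs"
  by (induction xs arbitrary: F) (simp_all add: algebra_simps)

lemma esum_sum: "esum (\<lambda>y ys. \<Sum>k\<in>K. F k y ys) xs = (\<Sum>k\<in>K. esum (F k) xs)"
  by (induction xs arbitrary: F) (simp_all add: sum_subtractf)

lemma esum_map: "esum F (map g xs) = esum (\<lambda>y ys. F (g y) (map g ys)) xs"
  by (induction xs arbitrary: F) simp_all

text \<open>Positions in \<open>vs\<close> are shifted by \<open>length us\<close>, hence the extra
  sign.\<close>

lemma esum_append:
  "esum F (us @ vs) =
     esum (\<lambda>y ys. F y (ys @ vs)) us + (- 1) ^ length us * esum (\<lambda>y ys. F y (us @ ys)) vs"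
  by (induction us arbitrary: F) simp_all

text \<open>When two entries are removed one after the other, the later one has its position lowered
  by one exactly if it goes second; exchanging the order therefore flips the sign.\<close>

lemma esum_esum_antisym:
  "esum (\<lambda>y ys. esum (F y) ys) xs = - esum (\<lambda>y ys. esum (\<lambda>z. F z y) ys) xs"
proof (induction xs arbitrary: F)
  case (Cons x xs)
  show ?case
    using Cons.IH[of "\<lambda>y z ys. F y z (x # ys)"] by (simp add: esum_diff)
qed simp

text \<open>The two orders of removing a pair of entries cancel. Antisymmetry alone would only show
  that twice the sum is 0, hence a separate induction.\<close>

lemma esum_esum_symmetric:
  assumes "\<And>y z ys. F y z ys = F z y ys"
  shows "esum (\<lambda>y ys. esum (F y) ys) xs = 0"
  using assms
proof (induction xs arbitrary: F)
  case (Cons x xs)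
  have "esum (\<lambda>y ys. esum (\<lambda>z zs. F y z (x # zs)) ys) xs = 0"
    by (rule Cons.IH) (rule Cons.prems)
  moreover have "(\<lambda>y. F y x) = F x" using Cons.prems by blast
  then have "esum (\<lambda>y. F y x) xs = esum (F x) xs" by simp
  ultimately show ?case by (simp add: esum_diff)
qed simp

lemma pf_Nil [simp]: "pf f [] = 1"
  using Pf_mat[of 0 "\<lambda>i j. f ([] ! i) ([] ! j)"] by (simp add: pf_def pfaffian_sum_0)

lemma pf_odd: "odd (length xs) \<Longrightarrow> pf f xs = 0"
  by (simp add: pf_def Pf_def)

text \<open>This is \<open>pfaffian_sum_Suc\<close> for lists. When \<open>x # xs\<close> has odd
  length both sides are 0, so users of the expansion need not track parity.\<close>

lemma pf_Cons: "pf f (x # xs) = esum (\<lambda>y ys. f x y * pf f ys) xs"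
proof (cases "even (length xs)")
  case True
  have "esum (\<lambda>y ys. f x y * pf f ys) xs = esum (\<lambda>y ys. 0) xs"
  proof (rule esum_cong)
    fix y ys assume "mset (y # ys) = mset xs"
    then have "Suc (length ys) = length xs" by (metis length_Cons size_mset)
    then have "odd (length ys)" using True by (metis even_Suc)
    then show "f x y * pf f ys = 0" by (simp add: pf_odd)
  qed
  then show ?thesis using True by (simp add: pf_odd)
next
  case False
  then obtain r where r: "length xs = Suc (2 * r)" by (metis oddE Suc_eq_plus1)
  have "pf f (x # xs) = pfaffian_sum (Suc r) (\<lambda>i j. f ((x # xs) ! i) ((x # xs) ! j))"
    using Pf_mat[of "Suc r" "\<lambda>i j. f ((x # xs) ! i) ((x # xs) ! j)"] by (simp add: pf_def r)
  also have "\<dots> = (\<Sum>j<length xs. (- 1) ^ j *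
     (f x (xs ! j) * pf f (take j xs @ drop (Suc j) xs)))"
    unfolding pfaffian_sum_Suc r[symmetric]
  proof (intro sum.cong refl)
    fix j assume "j \<in> {..<length xs}"
    then have j: "j < length xs" by simp
    let ?ys = "take j xs @ drop (Suc j) xs"
    have len: "length ?ys = 2 * r" using j r by simp
    \<comment> \<open>Removing position \<open>j\<close> from the list is the reindexing by
      \<open>insert_index j\<close> that occurs in the minor.\<close>
    have nth: "?ys ! a = xs ! insert_index j a" if "a < 2 * r" for a
      using j that r by (auto simp: nth_append insert_index_def)
    have "pf f ?ys = pfaffian_sum r (\<lambda>i j. f (?ys ! i) (?ys ! j))"
      unfolding pf_def len Pf_mat ..
    also have "\<dots> = pfaffian_sum r (\<lambda>a b. f (xs ! insert_index j a) (xs ! insert_index j b))"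
      by (rule pfaffian_sum_cong) (simp add: nth)
    finally show "(- 1) ^ j * f ((x # xs) ! 0) ((x # xs) ! Suc j) *
        pfaffian_sum r (\<lambda>a b. f ((x # xs) ! Suc (insert_index j a)) ((x # xs) ! Suc (insert_index j b))) =
        (- 1) ^ j * (f x (xs ! j) * pf f ?ys)"
      by (simp add: mult.assoc)
  qed
  finally show ?thesis by (simp add: esum_nth)
qed

text \<open>A perfect matching covers every index once, which gives one factor \<open>c y\<close>
  per index and one factor \<open>u\<close> per pair.\<close>

lemma pf_scale:
  assumes "\<And>a b. g a b = u * c a * c b * f a b"
  shows "pf g xs = u ^ (length xs div 2) * (\<Prod>y\<in>#mset xs. c y) * pf f xs"
proof (induction xs rule: length_induct)
  case (1 xs)
  show ?case
  proof (cases xs)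
    case (Cons x zs)
    have "esum (\<lambda>y ys. g x y * pf g ys) zs =
      esum (\<lambda>y ys. u ^ (length xs div 2) * (\<Prod>y\<in>#mset xs. c y) * (f x y * pf f ys)) zs"
    proof (rule esum_cong)
      fix y ys assume eq: "mset (y # ys) = mset zs"
      have len: "Suc (length ys) = length zs" using eq by (metis length_Cons size_mset)
      have "pf g ys = u ^ (length ys div 2) * (\<Prod>y\<in>#mset ys. c y) * pf f ys"
        using 1 len Cons by simp
      moreover have "(\<Prod>y\<in>#mset xs. c y) = c x * (c y * (\<Prod>y\<in>#mset ys. c y))"
        by (simp add: Cons eq[symmetric])
      moreover have "length xs div 2 = Suc (length ys div 2)" by (simp add: Cons len[symmetric])
      ultimately show "g x y * pf g ys =
          u ^ (length xs div 2) * (\<Prod>y\<in>#mset xs. c y) * (f x y * pf f ys)"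
        by (simp add: assms algebra_simps)
    qed
    then show ?thesis by (simp add: Cons pf_Cons esum_cmult)
  qed simp
qed

subsection \<open>Alternation\<close>

locale skew_form =
  fixes f :: "'b \<Rightarrow> 'b \<Rightarrow> 'a::comm_ring_1"
  assumes skew: "f y x = - f x y" and diag [simp]: "f x x = 0"
begin

text \<open>Expansion along the first row shortens the surrounding lists until the adjacent pair
  itself is in front. The vanishing for a repeated index is proved alongside, since the sign change
  only yields that twice the Pfaffian is 0.\<close>

lemma pf_swap_aux:
  "pf f (us @ a # b # vs) + pf f (us @ b # a # vs) = 0 \<and> pf f (us @ a # a # vs) = 0"
proof (induction "length us + length vs" arbitrary: us vs a b rule: less_induct)
  case less
  show ?case
  proof (cases us)
    case Nil
    \<comment> \<open>Two expansions either match \<open>a\<close> with \<open>b\<close> or, in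
      \<open>?D\<close>, match them with two entries of \<open>vs\<close>. The first term changes
      sign by skewness, the second by exchanging the order of removal.\<close>
    let ?D = "\<lambda>a b. esum (\<lambda>y ys. esum (\<lambda>z zs. f a y * (f b z * pf f zs)) ys) vs"
    have expand: "pf f (a # b # vs) = f a b * pf f vs - ?D a b" for a b
      by (simp add: pf_Cons esum_cmult)
    have "?D a b = - ?D b a"
      by (subst esum_esum_antisym) (simp add: mult.left_commute)
    moreover have "?D a a = 0"
      by (rule esum_esum_symmetric) (simp add: mult.left_commute)
    ultimately show ?thesis
      using skew[of a b] by (simp add: Nil expand)
  next
    case (Cons x us')
    have IH1: "pf f (ys @ a # b # vs) + pf f (ys @ b # a # vs) = 0"
       "pf f (ys @ a # a # vs) = 0" if "mset (y # ys) = mset us'" for y ys a b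
    proof -
      have "Suc (length ys) = length us'" using that by (metis length_Cons size_mset)
      then show "pf f (ys @ a # b # vs) + pf f (ys @ b # a # vs) = 0"
       "pf f (ys @ a # a # vs) = 0"
       using less[of ys vs] by (simp_all add: Cons)
    qed
    have IH2: "pf f (us' @ a # b # ys) + pf f (us' @ b # a # ys) = 0"
       "pf f (us' @ a # a # ys) = 0" if "mset (y # ys) = mset vs" for y ys a b
    proof -
      have "Suc (length ys) = length vs" using that by (metis length_Cons size_mset)
      then show "pf f (us' @ a # b # ys) + pf f (us' @ b # a # ys) = 0"
       "pf f (us' @ a # a # ys) = 0"
       using less[of us' ys] by (simp_all add: Cons)
    qed
    let ?E1 = "\<lambda>a b. esum (\<lambda>y ys. f x y * pf f (ys @ a # b # vs)) us'"
    let ?E2 = "\<lambda>a b. esum (\<lambda>y ys. f x y * pf f (us' @ a # b # ys)) vs"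
    \<comment> \<open>The partner of \<open>x\<close> lies in \<open>us'\<close>, is one of
      \<open>a\<close> and \<open>b\<close>, or lies in \<open>vs\<close>. The two middle terms
      cancel on swapping and for \<open>a = b\<close>; the outer ones fall to the induction
      hypothesis.\<close>
    have expand: "pf f (us @ a # b # vs) = ?E1 a b + (- 1) ^ length us' *
       (f x a * pf f (us' @ b # vs) - f x b * pf f (us' @ a # vs) + ?E2 a b)" for a b
      by (simp add: Cons pf_Cons esum_append diff_diff_eq2 diff_add_eq)
    have "?E1 a b + ?E1 b a = 0" "?E2 a b + ?E2 b a = 0"
      unfolding esum_add[symmetric] distrib_left[symmetric]
      by (subst esum_cong[where G="\<lambda>_ _. 0"]; simp add: IH1 IH2)+
    moreover have "?E1 a a = 0" "?E2 a a = 0"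
      by (subst esum_cong[where G="\<lambda>_ _. 0"]; simp add: IH1 IH2)+
    moreover have "pf f (us @ a # b # vs) + pf f (us @ b # a # vs) =
       (?E1 a b + ?E1 b a) + (- 1) ^ length us' * (?E2 a b + ?E2 b a)"
      unfolding expand by (simp add: algebra_simps)
    ultimately show ?thesis by (simp add: expand)
  qed
qed

text \<open>Moving \<open>k\<close> to the front takes \<open>length us\<close> adjacent
  swaps.\<close>

lemma pf_move: "pf f (us @ k # vs) = (- 1) ^ length us * pf f (k # us @ vs)"
proof (induction us arbitrary: vs rule: rev_induct)
  case (snoc u us)
  have "pf f (us @ u # k # vs) = - pf f (us @ k # u # vs)"
    using pf_swap_aux[of us u k vs] by (simp add: eq_neg_iff_add_eq_0)
  then show ?case by (simp add: snoc.IH)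
qed simp

text \<open>The front copy of \<open>k\<close> is moved next to the other one.\<close>

lemma pf_repeated:
  assumes "k \<in> set xs"
  shows "pf f (k # xs) = 0"
proof -
  obtain us vs where "xs = us @ k # vs" using split_list[OF assms] by blast
  then have "pf f (k # xs) = (- 1) ^ Suc (length us) * pf f (us @ k # k # vs) * - 1"
    using pf_move[of "us" k "k # vs"] by simp
  then show ?thesis using pf_swap_aux[of us k k vs] by simp
qed

end

subsection \<open>The summation formula\<close>

text \<open>A block matrix as a form on a disjoint union: the constructors select the block, so no
  index offsets occur.\<close>

fun block_form ::
  "('p \<Rightarrow> 'p \<Rightarrow> 'a::comm_ring_1) \<Rightarrow> ('p \<Rightarrow> 'q \<Rightarrow> 'a) \<Rightarrow> ('q \<Rightarrow> 'q \<Rightarrow> 'a) \<Rightarrow> 'p + 'q \<Rightarrow> 'p + 'q \<Rightarrow> 'a"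
where
  "block_form A S B (Inl i) (Inl j) = A i j"
| "block_form A S B (Inl i) (Inr k) = S i k"
| "block_form A S B (Inr k) (Inl i) = - S i k"
| "block_form A S B (Inr k) (Inr k') = B k k'"

lemma skew_form_block_form:
  assumes "skew_form A" "skew_form B"
  shows "skew_form (block_form A S B)"
proof
  show "block_form A S B y x = - block_form A S B x y" for x y
    by (cases x; cases y) (auto intro: skew_form.skew[OF assms(1)] skew_form.skew[OF assms(2)])
  show "block_form A S B x x = 0" for x
    using skew_form.diag[OF assms(1)] skew_form.diag[OF assms(2)] by (cases x) auto
qed

text \<open>With two separate lists, an expansion can remove indices from either block.\<close>

definition block_pf where
  "block_pf A S B P Q = pf (block_form A S B) (map Inl P @ map Inr Q)"

lemma block_pf_Cons:
  "block_pf A S B (p # P) Q =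
     esum (\<lambda>y ys. A p y * block_pf A S B ys Q) P +
     (- 1) ^ length P * esum (\<lambda>k ks. S p k * block_pf A S B P ks) Q"
  by (simp add: block_pf_def pf_Cons esum_append esum_map)

section \<open>Removing an element from a subset\<close>

lemma remove1_nth:
  "distinct xs \<Longrightarrow> i < length xs \<Longrightarrow> remove1 (xs ! i) xs = take i xs @ drop (Suc i) xs"
proof (induction xs arbitrary: i)
  case (Cons x xs)
  then show ?case by (cases i) auto
qed simp

lemma sum_nth_sorted_list_of_set:
  assumes "finite K"
  shows "(\<Sum>i<card K. H (sorted_list_of_set K ! i)
            (take i (sorted_list_of_set K) @ drop (Suc i) (sorted_list_of_set K))) =
         (\<Sum>k\<in>K. H k (sorted_list_of_set (K - {k})))"
proof -
  let ?xs = "sorted_list_of_set K"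
  have "bij_betw ((!) ?xs) {..<card K} K"
    using bij_betw_nth[of ?xs "{..<card K}" K] assms by simp
  then have "(\<Sum>k\<in>K. H k (sorted_list_of_set (K - {k}))) =
      (\<Sum>i<card K. H (?xs ! i) (sorted_list_of_set (K - {?xs ! i})))"
    by (rule sum.reindex_bij_betw[symmetric])
  also have "\<dots> = (\<Sum>i<card K. H (?xs ! i) (take i ?xs @ drop (Suc i) ?xs))"
    by (intro sum.cong refl) (simp add: sorted_list_of_set_remove assms remove1_nth)
  finally show ?thesis ..
qed

text \<open>The pairs \<open>(K, k)\<close> with \<open>k\<close> in \<open>K\<close> correspond to
  the pairs with \<open>k\<close> outside \<open>K\<close> by removing and inserting
  \<open>k\<close>.\<close>

lemma sum_Pow_remove:
  assumes "finite L"
  shows "(\<Sum>K\<in>Pow L. \<Sum>k\<in>K. H k (K - {k})) = (\<Sum>K\<in>Pow L. \<Sum>k\<in>L - K. H k K)"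
proof -
  have fin: "\<And>K. K \<in> Pow L \<Longrightarrow> finite K" using assms finite_subset by auto
  have "(\<Sum>K\<in>Pow L. \<Sum>k\<in>K. H k (K - {k})) = (\<Sum>(K, k)\<in>Sigma (Pow L) (\<lambda>K. K). H k (K - {k}))"
    using assms fin by (intro sum.Sigma) auto
  also have "\<dots> = (\<Sum>(K, k)\<in>Sigma (Pow L) (\<lambda>K. L - K). H k K)"
    by (rule sum.reindex_bij_witness[where i="\<lambda>(K, k). (insert k K, k)" and j="\<lambda>(K, k). (K - {k}, k)"])
      auto
  also have "\<dots> = (\<Sum>K\<in>Pow L. \<Sum>k\<in>L - K. H k K)"
    using assms by (intro sum.Sigma[symmetric]) auto
  finally show ?thesis .
qed

context skew_form
begin

text \<open>Bringing the \<open>i\<close>-th entry of \<open>xs\<close> to the front of the Pfaffian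
  passes \<open>length us + i\<close> indices; the part \<open>(- 1) ^ i\<close> cancels the sign of
  its removal in \<open>esum\<close>.\<close>

lemma esum_mult_pf:
  "esum F xs * pf f (us @ map g xs) = (- 1) ^ length us *
     (\<Sum>i<length xs. F (xs ! i) (take i xs @ drop (Suc i) xs) *
        pf f (g (xs ! i) # us @ map g (take i xs @ drop (Suc i) xs)))"
  unfolding esum_nth sum_distrib_left sum_distrib_right
proof (intro sum.cong refl)
  fix i assume "i \<in> {..<length xs}"
  then have i: "i < length xs" by simp
  let ?ys = "take i xs @ drop (Suc i) xs"
  have "us @ map g xs = (us @ map g (take i xs)) @ g (xs ! i) # map g (drop (Suc i) xs)"
    using arg_cong[OF id_take_nth_drop[OF i], of "map g"] by simp
  then have "pf f (us @ map g xs) = (- 1) ^ (length us + i) * pf f (g (xs ! i) # us @ map g ?ys)"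
    using i pf_move[of "us @ map g (take i xs)" "g (xs ! i)" "map g (drop (Suc i) xs)"] by simp
  moreover have "(- 1) ^ i * (- 1 :: 'a) ^ (length us + i) = (- 1) ^ length us"
    by (auto simp: minus_one_power_iff)
  moreover have "s * x * (t * y) = s * t * (x * y)" for s t x y :: 'a
    by (simp only: mult_ac)
  ultimately show "(- 1) ^ i * F (xs ! i) ?ys * pf f (us @ map g xs) =
      (- 1) ^ length us * (F (xs ! i) ?ys * pf f (g (xs ! i) # us @ map g ?ys))"
    by (simp only:)
qed

end

lemma Suc_choose_2: "Suc n choose 2 = n + (n choose 2)"
  by (simp add: numeral_2_eq_2)

text \<open>The index lists are arbitrary because the induction on \<open>P\<close> also removes
  entries of \<open>Q\<close>. The sum runs over all subsets; those of the wrong parity contribute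
  0.\<close>

lemma sum_block_pf_mult:
  fixes A :: "'p \<Rightarrow> 'p \<Rightarrow> 'a::comm_ring_1" and B :: "'q \<Rightarrow> 'q \<Rightarrow> 'a"
    and S :: "'p \<Rightarrow> 'k::linorder \<Rightarrow> 'a"
  assumes B: "skew_form B" and L: "finite L"
  shows "(\<Sum>K\<in>Pow L. (- 1) ^ (card K choose 2) *
           block_pf A S (\<lambda>_ _. 0) P (sorted_list_of_set K) *
           block_pf B T (\<lambda>_ _. 0) Q (sorted_list_of_set K)) =
         block_pf A (\<lambda>p q. \<Sum>k\<in>L. S p k * T q k) B P Q"
proof (induction P arbitrary: Q rule: length_induct)
  case (1 P)
  let ?s = "\<lambda>K. sorted_list_of_set K"
  let ?A = "\<lambda>P K. block_pf A S (\<lambda>_ _. 0) P (?s K)"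
  let ?B = "\<lambda>Q K. block_pf B T (\<lambda>_ _. 0) Q (?s K)"
  let ?ST = "\<lambda>p q. \<Sum>k\<in>L. S p k * T q k"
  let ?\<epsilon> = "\<lambda>K. (- 1 :: 'a) ^ (card K choose 2)"
  have finK: "finite K" if "K \<in> Pow L" for K using that L finite_subset by auto
  show ?case
  proof (cases P)
    case Nil
    \<comment> \<open>For empty \<open>P\<close> the first factor is the Pfaffian of a zero matrix,
      so only the empty \<open>K\<close> survives.\<close>
    have zero: "?A [] K = 0" if "K \<in> Pow L - {{}}" for K
    proof -
      have "?s K \<noteq> []" using that finK by auto
      then obtain k ks where "?s K = k # ks" by (cases "?s K") auto
      then show ?thesis by (simp add: block_pf_def pf_Cons esum_map)
    qed
    have "(\<Sum>K\<in>Pow L. ?\<epsilon> K * ?A [] K * ?B Q K) = (\<Sum>K\<in>{{}}. ?\<epsilon> K * ?A [] K * ?B Q K)"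
      using L by (intro sum.mono_neutral_right) (auto simp: zero)
    also have "\<dots> = pf B Q"
    proof -
      have pf_Inl: "pf (block_form C U D) (map Inl Q) = pf C Q"
        for C :: "'q \<Rightarrow> 'q \<Rightarrow> 'a" and U :: "'q \<Rightarrow> 'k \<Rightarrow> 'a" and D
        unfolding pf_def by (rule arg_cong[of _ _ Pf]) auto
      show ?thesis by (simp add: block_pf_def pf_Inl numeral_2_eq_2)
    qed
    also have "\<dots> = pf (block_form A ?ST B) (map Inr Q)"
      unfolding pf_def by (rule arg_cong[of _ _ Pf]) auto
    finally show ?thesis by (simp add: Nil block_pf_def)
  next
    case (Cons p P')
    interpret B: skew_form "block_form B T (\<lambda>_ _. 0)"
      by (rule skew_form_block_form[OF B]) (unfold_locales, auto)
    let ?N = "\<lambda>k K. pf (block_form B T (\<lambda>_ _. 0)) (Inr k # map Inl Q @ map Inr (?s K))"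
    let ?IH = "\<lambda>P Q. \<Sum>K\<in>Pow L. ?\<epsilon> K * ?A P K * ?B Q K"
    have IH: "?IH ys Q = block_pf A ?ST B ys Q" if "length ys \<le> length P'" for ys Q
      by (rule 1[rule_format]) (use that in \<open>simp add: Cons\<close>)
    \<comment> \<open>Here \<open>p\<close> is matched inside \<open>P'\<close>, and
      \<open>Q\<close> stays fixed.\<close>
    have part1: "(\<Sum>K\<in>Pow L. ?\<epsilon> K * esum (\<lambda>y ys. A p y * ?A ys K) P' * ?B Q K) =
        esum (\<lambda>y ys. A p y * block_pf A ?ST B ys Q) P'"
    proof -
      have "(\<Sum>K\<in>Pow L. ?\<epsilon> K * esum (\<lambda>y ys. A p y * ?A ys K) P' * ?B Q K) =
         (\<Sum>K\<in>Pow L. esum (\<lambda>y ys. A p y * (?\<epsilon> K * ?A ys K * ?B Q K)) P')"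
      proof (intro sum.cong refl)
        fix K
        have "esum (\<lambda>y ys. A p y * (?\<epsilon> K * ?A ys K * ?B Q K)) P' =
            esum (\<lambda>y ys. (?\<epsilon> K * ?B Q K) * (A p y * ?A ys K)) P'"
          by (simp only: mult_ac)
        also have "\<dots> = ?\<epsilon> K * ?B Q K * esum (\<lambda>y ys. A p y * ?A ys K) P'"
          by (rule esum_cmult)
        finally show "?\<epsilon> K * esum (\<lambda>y ys. A p y * ?A ys K) P' * ?B Q K =
            esum (\<lambda>y ys. A p y * (?\<epsilon> K * ?A ys K * ?B Q K)) P'"
          by (simp only: mult_ac)
      qed
      also have "\<dots> = esum (\<lambda>y ys. A p y * ?IH ys Q) P'"
        by (simp only: esum_sum sum_distrib_left)
      also have "\<dots> = esum (\<lambda>y ys. A p y * block_pf A ?ST B ys Q) P'"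
      proof (rule esum_cong)
        fix y ys assume "mset (y # ys) = mset P'"
        then have "Suc (length ys) = length P'" by (metis length_Cons size_mset)
        then show "A p y * ?IH ys Q = A p y * block_pf A ?ST B ys Q" by (simp add: IH)
      qed
      finally show ?thesis .
    qed
    \<comment> \<open>The zero block leaves only partners \<open>q\<close> in \<open>Q\<close>; the
      minus sign comes from the lower left block.\<close>
    have N: "?N k K = esum (\<lambda>q qs. - T q k * ?B qs K) Q" for k K
      by (simp add: pf_Cons esum_append esum_map block_pf_def)
    \<comment> \<open>\<open>K\<close> is now the set left after removing \<open>k\<close>;
      \<open>Suc (card K)\<close> keeps the sign of the original set.\<close>
    let ?H = "\<lambda>k K. (- 1) ^ (Suc (card K) choose 2) * (- 1) ^ length Q * S p k * ?A P' K * ?N k K"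
    have part2: "(\<Sum>K\<in>Pow L. ?\<epsilon> K * esum (\<lambda>k ks. S p k * block_pf A S (\<lambda>_ _. 0) P' ks) (?s K) * ?B Q K) =
        esum (\<lambda>q qs. ?ST p q * block_pf A ?ST B P' qs) Q"
    proof -
      have "(\<Sum>K\<in>Pow L. ?\<epsilon> K * esum (\<lambda>k ks. S p k * block_pf A S (\<lambda>_ _. 0) P' ks) (?s K) * ?B Q K) =
          (\<Sum>K\<in>Pow L. \<Sum>k\<in>K. ?H k (K - {k}))"
      proof (intro sum.cong refl)
        fix K assume K: "K \<in> Pow L"
        have "esum (\<lambda>k ks. S p k * block_pf A S (\<lambda>_ _. 0) P' ks) (?s K) * ?B Q K =
          (- 1) ^ length Q * (\<Sum>k\<in>K. S p k * ?A P' (K - {k}) * ?N k (K - {k}))"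
          unfolding block_pf_def[of B] B.esum_mult_pf
          using sum_nth_sorted_list_of_set[OF finK[OF K], of "\<lambda>k ks. S p k * block_pf A S (\<lambda>_ _. 0) P' ks *
            pf (block_form B T (\<lambda>_ _. 0)) (Inr k # map Inl Q @ map Inr ks)"] by simp
        moreover have "Suc (card (K - {k})) = card K" if "k \<in> K" for k
          using card_Suc_Diff1[OF finK[OF K] that] .
        ultimately show "?\<epsilon> K * esum (\<lambda>k ks. S p k * block_pf A S (\<lambda>_ _. 0) P' ks) (?s K) * ?B Q K =
            (\<Sum>k\<in>K. ?H k (K - {k}))"
          by (simp add: mult.assoc sum_distrib_left cong: sum.cong)
      qed
      also have "\<dots> = (\<Sum>K\<in>Pow L. \<Sum>k\<in>L - K. ?H k K)"
        using sum_Pow_remove[OF L, of ?H] .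
      \<comment> \<open>The added terms have \<open>k\<close> in \<open>K\<close>, so
        \<open>?N\<close> contains \<open>k\<close> twice and vanishes. The range of
        \<open>k\<close> no longer depends on \<open>K\<close>.\<close>
      also have "\<dots> = (\<Sum>K\<in>Pow L. \<Sum>k\<in>L. ?H k K)"
      proof (rule sum.cong[OF refl], rule sum.mono_neutral_left)
        fix K assume K: "K \<in> Pow L"
        show "\<forall>k\<in>L - (L - K). ?H k K = 0"
        proof
          fix k assume "k \<in> L - (L - K)"
          then have "Inr k \<in> set (map Inl Q @ map Inr (?s K))" using finK[OF K] by auto
          then show "?H k K = 0" by (simp only: B.pf_repeated mult_zero_right)
        qed
      qed (use L in auto)
      also have "\<dots> = (\<Sum>K\<in>Pow L. esum (\<lambda>q qs. ?ST p q * (?\<epsilon> K * ?A P' K * ?B qs K)) Q)"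
      proof (intro sum.cong refl)
        fix K assume K: "K \<in> Pow L"
        have "(\<Sum>k\<in>L. ?H k K) = esum (\<lambda>q qs. \<Sum>k\<in>L. (- 1) ^ (Suc (card K) choose 2) *
            (- 1) ^ length Q * S p k * ?A P' K * (- T q k * ?B qs K)) Q"
          by (simp only: N esum_sum esum_cmult)
        also have "\<dots> = esum (\<lambda>q qs. ?ST p q * (?\<epsilon> K * ?A P' K * ?B qs K)) Q"
        proof (rule esum_cong)
          fix q qs assume "mset (q # qs) = mset Q"
          then have len: "length Q = Suc (length qs)" by (metis length_Cons size_mset)
          show "(\<Sum>k\<in>L. (- 1) ^ (Suc (card K) choose 2) *
            (- 1) ^ length Q * S p k * ?A P' K * (- T q k * ?B qs K)) =
            ?ST p q * (?\<epsilon> K * ?A P' K * ?B qs K)"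
          \<comment> \<open>In the even case \<open>card K + length Q\<close> is odd, and the
            resulting sign cancels the one of \<open>- T q k\<close>. In the odd case the second
            Pfaffian has odd order.\<close>
          proof (cases "even (length qs + card K)")
            case True
            then have "(- 1 :: 'a) ^ (card K) * (- 1) ^ length qs = 1"
              by (simp add: add.commute flip: power_add)
            then have "(- 1 :: 'a) ^ (Suc (card K) choose 2) * (- 1) ^ length Q = - ?\<epsilon> K"
              unfolding Suc_choose_2 len power_add power_Suc
              by (metis (no_types, lifting) mult.commute mult.left_commute mult_1 mult_minus1)
            then show ?thesis by (simp add: sum_distrib_left sum_distrib_right mult_ac)
          next
            case False
            then have "?B qs K = 0" unfolding block_pf_def by (intro pf_odd) simp
            then show ?thesis by simp
          qed
        qed
        finally show "(\<Sum>k\<in>L. ?H k K) = esum (\<lambda>q qs. ?ST p q * (?\<epsilon> K * ?A P' K * ?B qs K)) Q" .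
      qed
      also have "\<dots> = esum (\<lambda>q qs. ?ST p q * ?IH P' qs) Q"
        by (simp only: esum_sum sum_distrib_left)
      also have "\<dots> = esum (\<lambda>q qs. ?ST p q * block_pf A ?ST B P' qs) Q"
        by (simp only: IH order_refl)
      finally show ?thesis .
    qed
    have "?IH P Q =
        (\<Sum>K\<in>Pow L. ?\<epsilon> K * esum (\<lambda>y ys. A p y * ?A ys K) P' * ?B Q K) +
        (- 1) ^ length P' * (\<Sum>K\<in>Pow L. ?\<epsilon> K *
           esum (\<lambda>k ks. S p k * block_pf A S (\<lambda>_ _. 0) P' ks) (?s K) * ?B Q K)"
      by (simp add: Cons block_pf_Cons distrib_left distrib_right sum.distrib sum_distrib_left mult_ac)
    also have "\<dots> = block_pf A ?ST B P Q"
      unfolding part1 part2 by (simp add: Cons block_pf_Cons)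
    finally show ?thesis .
  qed
qed

subsection \<open>Matrices\<close>

text \<open>Extended by zero, because \<open>skew_form\<close> speaks about all indices.\<close>

definition mat_form :: "'a::comm_ring_1 mat \<Rightarrow> nat \<Rightarrow> nat \<Rightarrow> 'a" where
  "mat_form X i j = (if i < dim_row X \<and> j < dim_col X then X $$ (i, j) else 0)"

lemma skew_form_mat_form:
  assumes "X \<in> carrier_mat n n" "skew_symmetric_mat X"
  shows "skew_form (mat_form X)"
proof
  have dims: "dim_row X = n" "dim_col X = n" using assms(1) by auto
  have "X\<^sup>T $$ (i, j) = (- X) $$ (i, j)" for i j
    using assms(2) by (simp add: skew_symmetric_mat_def)
  then have skew: "X $$ (j, i) = - X $$ (i, j)" if "i < n" "j < n" for i j
    using that dims by (metis index_transpose_mat(1) index_uminus_mat(1))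
  show "mat_form X y x = - mat_form X x y" for x y
    by (auto simp: mat_form_def dims intro: skew)
  show "mat_form X x x = 0" for x
    using assms(2) by (simp add: mat_form_def skew_symmetric_mat_def)
qed

text \<open>Keeping \<open>Q\<close> general serves both the bordered matrices, where it enumerates
  \<open>K\<close>, and the matrix on the right-hand side, where it is
  \<open>[0..<n]\<close>.\<close>

lemma Pf_four_block_mat:
  assumes A: "A \<in> carrier_mat m m" and D: "D \<in> carrier_mat (length Q) (length Q)"
    and "\<And>i j. i < m \<Longrightarrow> j < length Q \<Longrightarrow> U $$ (i, j) = S i (Q ! j)"
    and "\<And>i j. i < m \<Longrightarrow> j < length Q \<Longrightarrow> V $$ (j, i) = - S i (Q ! j)"
    and "\<And>i j. i < length Q \<Longrightarrow> j < length Q \<Longrightarrow> D $$ (i, j) = B (Q ! i) (Q ! j)"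
  shows "Pf (four_block_mat A U V D) = block_pf (mat_form A) S B [0..<m] Q"
  unfolding block_pf_def pf_def
  by (rule arg_cong[of _ _ Pf], rule eq_matI)
    (use assms in \<open>auto simp: nth_append mat_form_def\<close>)

text \<open>Both sides enumerate \<open>K\<close> increasingly, and such an enumeration is
  unique.\<close>

lemma pick_eq_nth_sorted_list_of_set:
  assumes "finite K" "i < card K"
  shows "pick K i = sorted_list_of_set K ! i"
proof -
  let ?xs = "map (pick K) [0..<card K]"
  have "sorted_wrt (<) ?xs"
    by (auto simp: sorted_wrt_iff_nth_less intro: pick_mono_le)
  moreover have "set ?xs = K"
  proof (rule card_subset_eq[OF assms(1)])
    show "set ?xs \<subseteq> K" by (auto intro: pick_in_set_le)
    show "card (set ?xs) = card K"
      using distinct_card[of ?xs] \<open>sorted_wrt (<) ?xs\<close> by (simp add: strict_sorted_iff)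
  qed
  ultimately have "sorted_list_of_set K = ?xs"
    using sorted_list_of_set.idem_if_sorted_distinct[of ?xs] by (simp add: strict_sorted_iff)
  then show ?thesis using assms(2) by simp
qed

lemma Pf_bordered:
  assumes A: "A \<in> carrier_mat m m" and S: "S \<in> carrier_mat m l" and K: "K \<subseteq> {0..<l}"
  shows "Pf (four_block_mat A (submatrix S {0..<m} K)
                  (- (submatrix S {0..<m} K)\<^sup>T) (0\<^sub>m (card K) (card K))) =
         block_pf (mat_form A) (mat_form S) (\<lambda>_ _. 0) [0..<m] (sorted_list_of_set K)"
proof (rule Pf_four_block_mat[OF A])
  have fin: "finite K" using K finite_subset by auto
  have Kl: "{j. j < l \<and> j \<in> K} = K" using K by auto
  have dims: "dim_row (submatrix S {0..<m} K) = m" "dim_col (submatrix S {0..<m} K) = card K"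
    using S by (simp_all add: dim_submatrix Kl)
  fix i j assume i: "i < m" and j: "j < length (sorted_list_of_set K)"
  have j': "j < card K" using j by simp
  \<comment> \<open>The bound ensures that \<open>mat_form S\<close> returns the matrix entry and
    not its default 0.\<close>
  have "sorted_list_of_set K ! j < l"
    using K nth_mem[OF j] fin by auto
  then show *: "submatrix S {0..<m} K $$ (i, j) = mat_form S i (sorted_list_of_set K ! j)"
    using S i j' pick_eq_nth_sorted_list_of_set[of "{0..<m}" i] pick_eq_nth_sorted_list_of_set[OF fin j']
    by (subst submatrix_index) (simp_all add: Kl mat_form_def)
  show "(- (submatrix S {0..<m} K)\<^sup>T) $$ (j, i) = - mat_form S i (sorted_list_of_set K ! j)"
    using i j' by (simp add: dims * )
qed auto

section \<open>Signs for the second identity\<close>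

text \<open>Scaling with \<open>u = - 1\<close> and with \<open>c\<close> equal to 1 on the left and
  -1 on the right summand negates \<open>B\<close> but fixes the blocks of \<open>T\<close>, where
  the two signs cancel.\<close>

lemma block_pf_uminus:
  fixes B :: "'p \<Rightarrow> 'p \<Rightarrow> 'a::comm_ring_1" and T :: "'p \<Rightarrow> 'q \<Rightarrow> 'a"
  shows "block_pf (\<lambda>i j. - B i j) T (\<lambda>_ _. 0) P Q =
     (- 1) ^ ((length P + length Q) div 2) * (- 1) ^ length Q * block_pf B T (\<lambda>_ _. 0) P Q"
proof -
  let ?c = "case_sum (\<lambda>_. 1) (\<lambda>_. - 1) :: 'p + 'q \<Rightarrow> 'a"
  have "block_form (\<lambda>i j. - B i j) T (\<lambda>_ _. 0) a b =
      - 1 * ?c a * ?c b * block_form B T (\<lambda>_ _. 0) a b" for a b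
    by (cases a; cases b) simp_all
  then have "block_pf (\<lambda>i j. - B i j) T (\<lambda>_ _. 0) P Q =
      (- 1) ^ ((length P + length Q) div 2) *
      (\<Prod>y\<in>#mset (map Inl P @ map Inr Q). ?c y) * block_pf B T (\<lambda>_ _. 0) P Q"
    unfolding block_pf_def by (subst pf_scale[where u="- 1" and c="?c"]) simp_all
  also have "(\<Prod>y\<in>#mset (map Inl P @ map Inr Q). ?c y) = (- 1) ^ length Q"
  proof (induction P)
    case Nil
    show ?case by (induction Q) simp_all
  qed simp
  finally show ?thesis .
qed

text \<open>The two binomials are \<open>a * (2 * a - 1)\<close> and \<open>a * (2 * a + 1)\<close>,
  each with an odd second factor.\<close>

lemma even_choose_two:
  "even (2 * a choose 2) \<longleftrightarrow> even a"
  "even (Suc (2 * a) choose 2) \<longleftrightarrow> even a"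
  by (induction a) (simp_all add: Suc_choose_2 binomial_eq_0)

text \<open>Writing \<open>n\<close> and \<open>k\<close> as \<open>2 * a\<close> and
  \<open>2 * b\<close>, or as their successors, makes the total exponent even. The last two factors
  are the sign from \<open>block_pf_uminus\<close>.\<close>

lemma choose_two_sign:
  assumes "n mod 2 = k mod 2"
  shows "(- 1 :: 'a::comm_ring_1) ^ (n choose 2) * ((- 1) ^ (k choose 2) * ((- 1) ^ ((n + k) div 2) * (- 1) ^ k)) = 1"
proof -
  have "even ((n choose 2) + ((k choose 2) + ((n + k) div 2 + k)))"
  proof (cases "even n")
    case True
    moreover have "even k" using True assms by presburger
    ultimately obtain a b where "n = 2 * a" "k = 2 * b" by (elim evenE)
    then show ?thesis by (auto simp: even_choose_two)
  next
    case False
    moreover have "odd k" using False assms by presburger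
    ultimately obtain a b where "n = Suc (2 * a)" "k = Suc (2 * b)" by (auto elim!: oddE)
    then show ?thesis by (auto simp: even_choose_two)
  qed
  then show ?thesis by (simp flip: power_add)
qed

theorem theorem3p2:
  fixes A B S T :: "'a::comm_ring_1 mat" and m n l :: nat
  assumes parity: "m mod 2 = n mod 2"
    and A: "A \<in> carrier_mat m m" "skew_symmetric_mat A"
    and B: "B \<in> carrier_mat n n" "skew_symmetric_mat B"
    and S: "S \<in> carrier_mat m l"
    and T: "T \<in> carrier_mat n l"
  shows "(\<Sum>K | K \<subseteq> {0..<l} \<and> card K mod 2 = m mod 2.
            (- 1) ^ (card K choose 2) *
            Pf (four_block_mat A (submatrix S {0..<m} K)
                  (- (submatrix S {0..<m} K)\<^sup>T) (0\<^sub>m (card K) (card K))) *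
            Pf (four_block_mat B (submatrix T {0..<n} K)
                  (- (submatrix T {0..<n} K)\<^sup>T) (0\<^sub>m (card K) (card K)))) =
         Pf (four_block_mat A (S * T\<^sup>T) (- (T * S\<^sup>T)) B) \<and>
         (\<Sum>K | K \<subseteq> {0..<l} \<and> card K mod 2 = m mod 2.
            Pf (four_block_mat A (submatrix S {0..<m} K)
                  (- (submatrix S {0..<m} K)\<^sup>T) (0\<^sub>m (card K) (card K))) *
            Pf (four_block_mat B (submatrix T {0..<n} K)
                  (- (submatrix T {0..<n} K)\<^sup>T) (0\<^sub>m (card K) (card K)))) =
         (- 1) ^ (n choose 2) * Pf (four_block_mat A (S * T\<^sup>T) (- (T * S\<^sup>T)) (- B))"
proof -
  let ?Ks = "{K. K \<subseteq> {0..<l} \<and> card K mod 2 = m mod 2}"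
  let ?s = "\<lambda>K. sorted_list_of_set K"
  let ?a = "\<lambda>K. block_pf (mat_form A) (mat_form S) (\<lambda>_ _. 0) [0..<m] (?s K)"
  let ?b = "\<lambda>C K. block_pf C (mat_form T) (\<lambda>_ _. 0) [0..<n] (?s K)"
  \<comment> \<open>\<open>C\<close> is left open: \<open>B\<close> gives the first identity,
    \<open>- B\<close> the second.\<close>
  have first: "(\<Sum>K\<in>?Ks. (- 1) ^ (card K choose 2) * ?a K * ?b (mat_form C) K) =
      Pf (four_block_mat A (S * T\<^sup>T) (- (T * S\<^sup>T)) C)"
    if C: "C \<in> carrier_mat n n" and skew: "skew_form (mat_form C)" for C
  proof -
    \<comment> \<open>Subsets of the wrong parity give a matrix of odd order, so the sum may be
      extended to all subsets.\<close>
    have "?a K = 0" if "K \<in> Pow {0..<l} - ?Ks" for K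
    proof -
      have "card K mod 2 \<noteq> m mod 2" using that by auto
      then have "odd (m + card K)" by presburger
      then show ?thesis by (simp add: block_pf_def pf_odd)
    qed
    then have "(\<Sum>K\<in>?Ks. (- 1) ^ (card K choose 2) * ?a K * ?b (mat_form C) K) =
        (\<Sum>K\<in>Pow {0..<l}. (- 1) ^ (card K choose 2) * ?a K * ?b (mat_form C) K)"
      by (intro sum.mono_neutral_left) auto
    also have "\<dots> = block_pf (mat_form A) (\<lambda>p q. \<Sum>k\<in>{0..<l}. mat_form S p k * mat_form T q k)
        (mat_form C) [0..<m] [0..<n]"
      by (rule sum_block_pf_mult[OF skew]) simp
    also have "\<dots> = Pf (four_block_mat A (S * T\<^sup>T) (- (T * S\<^sup>T)) C)"
      using S T C
      by (intro Pf_four_block_mat[symmetric] A)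
        (auto simp: mat_form_def scalar_prod_def mult.commute)
    finally show ?thesis .
  qed
  \<comment> \<open>\<open>(- 1) ^ (n choose 2)\<close> does not depend on \<open>K\<close> and
    leaves the sum; the other sign is the weight in the first identity for
    \<open>- B\<close>.\<close>
  have flip: "?b (mat_form B) K = (- 1) ^ (n choose 2) * ((- 1) ^ (card K choose 2) * ?b (mat_form (- B)) K)"
    if "K \<in> ?Ks" for K
  proof -
    have "mat_form (- B) = (\<lambda>i j. - mat_form B i j)"
      by (intro ext) (simp add: mat_form_def)
    then have "?b (mat_form (- B)) K = (- 1) ^ ((n + card K) div 2) * (- 1) ^ card K * ?b (mat_form B) K"
      by (simp add: block_pf_uminus)
    moreover have "n mod 2 = card K mod 2" using that parity by simp
    moreover have "e * (f * (s * c * b)) = b" if "e * (f * (s * c)) = 1" for e f s c b :: 'a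
      using that by (metis mult.assoc mult_1)
    ultimately show ?thesis using choose_two_sign[of n "card K", where ?'a='a] by simp
  qed
  have neg: "- B \<in> carrier_mat n n" using B(1) by simp
  have "(- B)\<^sup>T = - (- B)" using B by (simp add: skew_symmetric_mat_def transpose_uminus)
  then have "skew_form (mat_form (- B))"
    using B by (intro skew_form_mat_form[OF neg]) (simp add: skew_symmetric_mat_def)
  note first_neg = first[OF neg this]
  have "(\<Sum>K\<in>?Ks. ?a K * ?b (mat_form B) K) =
      (\<Sum>K\<in>?Ks. (- 1) ^ (n choose 2) * ((- 1) ^ (card K choose 2) * ?a K * ?b (mat_form (- B)) K))"
    by (intro sum.cong refl) (simp only: flip mult_ac)
  also have "\<dots> = (- 1) ^ (n choose 2) * Pf (four_block_mat A (S * T\<^sup>T) (- (T * S\<^sup>T)) (- B))"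
    by (simp only: first_neg flip: sum_distrib_left)
  finally have second: "(\<Sum>K\<in>?Ks. ?a K * ?b (mat_form B) K) =
      (- 1) ^ (n choose 2) * Pf (four_block_mat A (S * T\<^sup>T) (- (T * S\<^sup>T)) (- B))" .
  show ?thesis
    unfolding first[OF B(1) skew_form_mat_form[OF B], symmetric] second[symmetric]
    by (intro conjI sum.cong refl) (simp_all add: Pf_bordered[OF A(1) S] Pf_bordered[OF B(1) T])
qed

end
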